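(* Let $n \geq 4$ be an even integer. Every $4$-total coloring of every cubic graph of order $n$ is equitable if and only if $n \in \{4,6,8,10,14\}$, where the case $n=4$ holds vacuously because $K_4$ admits no $4$-total coloring. In particular, $n = 14$ is the largest order with this property.
   Context: All graphs are finite, simple and cubic ($3$-regular), not necessarily connected. The order of a graph is its number of vertices. A $4$-total coloring of $G$ assigns one of the four colors $1,2,3,4$ to each vertex and each edge of $G$ so that adjacent vertices receive distinct colors, adjacent edges (edges sharing an endpoint) receive distinct colors, and every vertex and edge that are incident receive distinct colors. The color class $c_i$ is the set of all vertices and edges of color $i$. The coloring is equitable if $\bigl||c_i|-|c_j|\bigr| \le 1$ for all $i,j \in \{1,2,3,4\}$. *)

theory Defs
  imports Main
begin

text \<open>A graph is given by a vertex set \<open>V\<close> and a set \<open>E\<close> of two-element subsets of \<open>V\<close>.\<close>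

definition complete_edges :: "'a set \<Rightarrow> 'a set set" where
  "complete_edges V = {e. e \<subseteq> V \<and> card e = 2}"

definition simple_graph :: "'a set \<Rightarrow> 'a set set \<Rightarrow> bool" where
  "simple_graph V E \<longleftrightarrow> finite V \<and> E \<subseteq> complete_edges V"

definition cubic_graph :: "'a set \<Rightarrow> 'a set set \<Rightarrow> bool" where
  "cubic_graph V E \<longleftrightarrow> simple_graph V E \<and> (\<forall>v\<in>V. card {e \<in> E. v \<in> e} = 3)"

text \<open>A total coloring colors the disjoint union \<open>V <+> E\<close>: \<open>c (Inl v)\<close> is the color of the
  vertex \<open>v\<close>, \<open>c (Inr e)\<close> that of the edge \<open>e\<close>. Values of \<open>c\<close> outside \<open>V <+> E\<close> are irrelevant.\<close>

definition four_total_coloring :: "'a set \<Rightarrow> 'a set set \<Rightarrow> ('a + 'a set \<Rightarrow> nat) \<Rightarrow> bool" where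
  "four_total_coloring V E c \<longleftrightarrow>
     c ` (V <+> E) \<subseteq> {1, 2, 3, 4} \<and>
     (\<forall>u\<in>V. \<forall>v\<in>V. {u, v} \<in> E \<longrightarrow> c (Inl u) \<noteq> c (Inl v)) \<and>
     (\<forall>e\<in>E. \<forall>f\<in>E. e \<noteq> f \<and> e \<inter> f \<noteq> {} \<longrightarrow> c (Inr e) \<noteq> c (Inr f)) \<and>
     (\<forall>v\<in>V. \<forall>e\<in>E. v \<in> e \<longrightarrow> c (Inl v) \<noteq> c (Inr e))"

definition color_class ::
  "'a set \<Rightarrow> 'a set set \<Rightarrow> ('a + 'a set \<Rightarrow> nat) \<Rightarrow> nat \<Rightarrow> ('a + 'a set) set" where
  "color_class V E c i = {x \<in> V <+> E. c x = i}"

definition equitable :: "'a set \<Rightarrow> 'a set set \<Rightarrow> ('a + 'a set \<Rightarrow> nat) \<Rightarrow> bool" where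
  "equitable V E c \<longleftrightarrow>
     (\<forall>i\<in>{1, 2, 3, 4}. \<forall>j\<in>{1, 2, 3, 4}.
        \<bar>int (card (color_class V E c i)) - int (card (color_class V E c j))\<bar> \<le> 1)"

text \<open>The type argument fixes the type from which the vertices are taken; it has to be large enough
  (e.g. infinite) for all cubic graphs of order \<open>n\<close> to occur up to isomorphism.\<close>

definition all_four_total_colorings_equitable :: "'a itself \<Rightarrow> nat \<Rightarrow> bool" where
  "all_four_total_colorings_equitable _ n \<longleftrightarrow>
     (\<forall>(V :: 'a set) E c. cubic_graph V E \<and> card V = n \<and> four_total_coloring V E c
        \<longrightarrow> equitable V E c)"

end

theory Submission
  imports Defs
begin

text \<open>In a 4-total coloring of a cubic graph all four colors occur at each vertex (on the vertex
  itself and on its three edges). So if color \<open>i\<close> is used on \<open>v\<^sub>i\<close> vertices and \<open>e\<^sub>i\<close> edges, then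
  \<open>v\<^sub>i + 2 e\<^sub>i = n\<close>; and since the vertices of color \<open>i\<close> are independent and each of them has an
  edge of color \<open>j\<close>, also \<open>v\<^sub>i \<le> e\<^sub>j\<close> for \<open>i \<noteq> j\<close>. For \<open>n \<in> {6, 8, 10, 14}\<close> the only solutions are
  equitable, and for \<open>n = 4\<close> there are none. The color class \<open>i\<close> has \<open>(n + v\<^sub>i) / 2\<close> elements, so
  \<open>v\<^sub>1 \<ge> v\<^sub>4 + 4\<close> prevents equitability; every other order is reached by disjoint unions of
  copies of a graph of order 6 with \<open>v = (2,2,2,0)\<close> and at most one graph of order 8 with
  \<open>v = (2,2,2,2)\<close> or of order 10 with \<open>v = (4,2,2,2)\<close>.\<close>

abbreviation colors :: "nat set" where
  "colors \<equiv> {1, 2, 3, 4}"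

definition color_vertices :: "'a set \<Rightarrow> ('a + 'a set \<Rightarrow> nat) \<Rightarrow> nat \<Rightarrow> 'a set" where
  "color_vertices V c i = {v \<in> V. c (Inl v) = i}"

definition color_edges :: "'a set set \<Rightarrow> ('a + 'a set \<Rightarrow> nat) \<Rightarrow> nat \<Rightarrow> 'a set set" where
  "color_edges E c i = {e \<in> E. c (Inr e) = i}"

section \<open>Counting\<close>

text \<open>As \<open>a1 + e1 = N - e1\<close>, a violation means \<open>e2 \<ge> e1 + 2\<close>,
  for which the inequalities leave no room. Colors 1 and 2 suffice, since any other pair arises by
  renaming. Order 12 escapes, with vertex counts 4, 0, 4, 4 and edge counts 4, 6, 4, 4.\<close>

lemma color_counts_nearly_equal:
  fixes a1 a2 a3 a4 e1 e2 e3 e4 N :: nat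
  assumes N: "N \<in> {6, 8, 10, 14}" and sum: "a1 + a2 + a3 + a4 = N"
    and eqs: "a1 + 2 * e1 = N" "a2 + 2 * e2 = N" "a3 + 2 * e3 = N" "a4 + 2 * e4 = N"
    and les: "a1 \<le> e3" "a1 \<le> e4" "a3 \<le> e4" "a4 \<le> e3"
  shows "a1 + e1 \<le> a2 + e2 + 1"
proof (rule ccontr)
  assume "\<not> ?thesis"
  then have "e2 \<ge> e1 + 2"
    using eqs by linarith
  moreover have sum': "2 * e1 + 2 * e2 + 2 * e3 + 2 * e4 = 3 * N"
    using sum eqs by simp
  moreover have *: "2 * e2 \<le> N" "e3 + 2 * e1 \<ge> N" "e4 + 2 * e1 \<ge> N" "e4 + 2 * e3 \<ge> N" "e3 + 2 * e4 \<ge> N"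
    using eqs les by simp_all
  \<comment> \<open>The two bounds containing \<open>2 * e1\<close> add up to
    \<open>4 * e1 + e3 + e4 \<ge> 2 * N\<close>; then \<open>e3 + e4\<close> is eliminated by
    \<open>sum'\<close> and \<open>e2\<close> by \<open>e2 \<ge> e1 + 2\<close>.\<close>
  moreover from calculation have "4 * e1 \<ge> N + 4"
    by linarith
  \<comment> \<open>From \<open>e1 + 2 \<le> e2\<close> and \<open>2 * e2 \<le> N\<close> also
    \<open>2 * e1 + 4 \<le> N\<close>. With the lower bound on \<open>e1\<close> this is impossible
    for 6, 8 and 10 and leaves one solution for 14.\<close>
  ultimately have "N = 14" "e1 = 5" "e2 = 7"
    using N by auto
  \<comment> \<open>Now \<open>e3 + e4 = 9\<close>, whereas the last two bounds in \<open>*\<close>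
    add up to \<open>3 * (e3 + e4) \<ge> 28\<close>.\<close>
  with * sum' show False
    by linarith
qed

text \<open>If \<open>e1 \<le> 1\<close>, then \<open>a1 \<ge> 2\<close> forces \<open>e2\<close>,
  \<open>e3\<close>, \<open>e4\<close> to be 2 and \<open>a2\<close>, \<open>a3\<close>,
  \<open>a4\<close> to be 0, so \<open>a1 = 4\<close> exceeds \<open>e2\<close>. By symmetry all
  edge counts are at least 2; then all vertex counts vanish and cannot sum to 4.\<close>

lemma color_counts_not_4:
  fixes a1 a2 a3 a4 e1 e2 e3 e4 N :: nat
  assumes N: "N = 4" and sum: "a1 + a2 + a3 + a4 = N"
    and eqs: "a1 + 2 * e1 = N" "a2 + 2 * e2 = N" "a3 + 2 * e3 = N" "a4 + 2 * e4 = N"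
    and les: "a1 \<le> e2" "a1 \<le> e3" "a1 \<le> e4" "a2 \<le> e1" "a2 \<le> e3" "a2 \<le> e4"
    "a3 \<le> e1" "a3 \<le> e2" "a3 \<le> e4" "a4 \<le> e1" "a4 \<le> e2" "a4 \<le> e3"
  shows False
proof -
  have "e1 \<ge> 2" "e2 \<ge> 2" "e3 \<ge> 2" "e4 \<ge> 2"
    using assms by linarith+
  then show False
    using N sum eqs by linarith
qed

section \<open>Counting in a fixed coloring\<close>

locale colored_cubic_graph =
  fixes V :: "'a set" and E :: "'a set set" and c :: "'a + 'a set \<Rightarrow> nat"
  assumes cubic: "cubic_graph V E"
    and coloring: "four_total_coloring V E c"
begin

lemma finite_V: "finite V"
  using cubic by (simp add: cubic_graph_def simple_graph_def)

lemma edge_subset: "e \<in> E \<Longrightarrow> e \<subseteq> V"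
  and edge_card: "e \<in> E \<Longrightarrow> card e = 2"
  using cubic by (auto simp: cubic_graph_def simple_graph_def complete_edges_def)

lemma finite_E: "finite E"
  by (rule finite_subset[of _ "Pow V"]) (use edge_subset finite_V in auto)

lemma vertex_color: "v \<in> V \<Longrightarrow> c (Inl v) \<in> colors"
  and edge_color: "e \<in> E \<Longrightarrow> c (Inr e) \<in> colors"
  using coloring by (auto simp: four_total_coloring_def)

lemma adjacent_color: "{u, v} \<in> E \<Longrightarrow> u \<in> V \<Longrightarrow> v \<in> V \<Longrightarrow> c (Inl u) \<noteq> c (Inl v)"
  using coloring by (simp add: four_total_coloring_def)

lemma edge_color_inj: "e \<in> E \<Longrightarrow> f \<in> E \<Longrightarrow> v \<in> e \<Longrightarrow> v \<in> f \<Longrightarrow> c (Inr e) = c (Inr f) \<Longrightarrow> e = f"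
proof -
  assume ef: "e \<in> E" "f \<in> E" "v \<in> e" "v \<in> f" "c (Inr e) = c (Inr f)"
  have "\<forall>e\<in>E. \<forall>f\<in>E. e \<noteq> f \<and> e \<inter> f \<noteq> {} \<longrightarrow> c (Inr e) \<noteq> c (Inr f)"
    using coloring by (simp add: four_total_coloring_def)
  with ef show "e = f"
    by blast
qed

lemma vertex_edge_color: "v \<in> V \<Longrightarrow> e \<in> E \<Longrightarrow> v \<in> e \<Longrightarrow> c (Inl v) \<noteq> c (Inr e)"
  using coloring by (simp add: four_total_coloring_def)

text \<open>The three edges at \<open>v\<close> have distinct colors, none of them that of
  \<open>v\<close>, so they use up the three remaining colors.\<close>

lemma ex_edge_color:
  assumes v: "v \<in> V" and j: "j \<in> colors" "j \<noteq> c (Inl v)"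
  shows "\<exists>e\<in>E. v \<in> e \<and> c (Inr e) = j"
proof -
  let ?I = "{e \<in> E. v \<in> e}" and ?f = "\<lambda>e. c (Inr e)"
  have "inj_on ?f ?I"
    by (rule inj_onI) (use edge_color_inj in auto)
  then have "card (?f ` ?I) = 3"
    using cubic v by (simp add: card_image cubic_graph_def)
  moreover have "card (colors - {c (Inl v)}) = 3"
    using vertex_color[OF v] by auto
  moreover have "?f ` ?I \<subseteq> colors - {c (Inl v)}"
    using edge_color vertex_edge_color[OF v] by fastforce
  ultimately have "?f ` ?I = colors - {c (Inl v)}"
    by (intro card_subset_eq) auto
  then have "j \<in> ?f ` ?I"
    using j by (simp only: insert_Diff_single Diff_iff) simp
  then show ?thesis
    by blast
qed

lemma sum_color_vertices: "(\<Sum>i\<in>colors. card (color_vertices V c i)) = card V"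
proof -
  have "V = (\<Union>i\<in>colors. color_vertices V c i)"
    using vertex_color by (auto simp: color_vertices_def)
  then have "card V = card (\<Union>i\<in>colors. color_vertices V c i)"
    by simp
  also have "\<dots> = (\<Sum>i\<in>colors. card (color_vertices V c i))"
    by (rule card_UN_disjoint) (use finite_V in \<open>auto simp: color_vertices_def\<close>)
  finally show ?thesis ..
qed

text \<open>The edges of color \<open>i\<close> form a matching, and by \<open>ex_edge_color\<close>
  it covers exactly the vertices not colored \<open>i\<close>.\<close>

lemma vertices_plus_edges:
  assumes "i \<in> colors"
  shows "card (color_vertices V c i) + 2 * card (color_edges E c i) = card V"
proof -
  let ?X = "color_vertices V c i" and ?Y = "color_edges E c i"
  have "V = ?X \<union> \<Union>?Y"
    using ex_edge_color[OF _ assms] edge_subset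
    by (fastforce simp: color_vertices_def color_edges_def)
  moreover have "?X \<inter> \<Union>?Y = {}"
    using vertex_edge_color by (fastforce simp: color_vertices_def color_edges_def)
  moreover have "finite ?X" "finite (\<Union>?Y)"
    using finite_V edge_subset finite_subset[of "\<Union>?Y" V]
    by (auto simp: color_vertices_def color_edges_def)
  ultimately have "card V = card ?X + card (\<Union>?Y)"
    by (metis card_Un_disjoint)
  moreover have "2 * card ?Y = card (\<Union>?Y)"
  proof (rule card_partition)
    show "finite ?Y" "finite (\<Union>?Y)"
      using finite_E \<open>finite (\<Union>?Y)\<close> by (auto simp: color_edges_def)
    show "\<And>e. e \<in> ?Y \<Longrightarrow> card e = 2"
      by (simp add: color_edges_def edge_card)
    show "\<And>e f. e \<in> ?Y \<Longrightarrow> f \<in> ?Y \<Longrightarrow> e \<noteq> f \<Longrightarrow> e \<inter> f = {}"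
      using edge_color_inj by (fastforce simp: color_edges_def)
  qed
  ultimately show ?thesis
    by simp
qed

lemma card_color_class:
  "card (color_class V E c i) = card (color_vertices V c i) + card (color_edges E c i)"
proof -
  have "color_class V E c i = color_vertices V c i <+> color_edges E c i"
    by (auto simp: color_class_def color_vertices_def color_edges_def)
  then show ?thesis
    using finite_V finite_E by (simp add: card_Plus color_vertices_def color_edges_def)
qed

text \<open>Sending each vertex of color \<open>i\<close> to its edge of color \<open>j\<close> is
  injective: two vertices with the same image would be the ends of that edge, hence adjacent with
  equal colors.\<close>

lemma vertices_le_edges:
  assumes j: "j \<in> colors" "i \<noteq> j"
  shows "card (color_vertices V c i) \<le> card (color_edges E c j)"
proof -
  have "\<forall>v\<in>color_vertices V c i. \<exists>e\<in>color_edges E c j. v \<in> e"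
    using ex_edge_color j by (fastforce simp: color_vertices_def color_edges_def)
  then obtain f where f: "\<And>v. v \<in> color_vertices V c i \<Longrightarrow> f v \<in> color_edges E c j \<and> v \<in> f v"
    by metis
  have "inj_on f (color_vertices V c i)"
  proof (rule inj_onI, rule ccontr)
    fix u v
    assume uv: "u \<in> color_vertices V c i" "v \<in> color_vertices V c i" "f u = f v" "u \<noteq> v"
    have e: "f u \<in> E" "{u, v} \<subseteq> f u"
      using f[OF uv(1)] f[OF uv(2)] uv(3) by (auto simp: color_edges_def)
    then have "f u = {u, v}"
      using edge_card[OF e(1)] uv(4) by (intro card_subset_eq[symmetric]) (auto intro: card_ge_0_finite)
    then have "{u, v} \<in> E"
      using e(1) by simp
    then show False
      using adjacent_color[of u v] uv(1,2) by (simp add: color_vertices_def)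
  qed
  then show ?thesis
    by (rule card_inj_on_le) (use f finite_E in \<open>auto simp: color_edges_def\<close>)
qed

lemma color_counts:
  assumes "colors = {i, j, k, l}" "distinct [i, j, k, l]"
  shows "card (color_vertices V c i) + card (color_vertices V c j) +
      card (color_vertices V c k) + card (color_vertices V c l) = card V"
  using sum_color_vertices assms(2) unfolding assms(1) by simp

lemma card_V_ne_4: "card V \<noteq> 4"
proof
  assume 4: "card V = 4"
  show False
    by (rule color_counts_not_4[OF 4 color_counts[of 1 2 3 4]])
      (auto intro!: vertices_plus_edges vertices_le_edges)
qed

text \<open>Here \<open>i\<close> and \<open>j\<close> take the roles of colors 1 and 2 in the
  arithmetic lemma, \<open>k\<close> and \<open>l\<close> those of 3 and 4.\<close>

lemma card_color_class_le:
  assumes card_V: "card V \<in> {6, 8, 10, 14}"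
    and colors: "colors = {i, j, k, l}" "distinct [i, j, k, l]"
  shows "card (color_class V E c i) \<le> card (color_class V E c j) + 1"
proof -
  have mem: "i \<in> colors" "j \<in> colors" "k \<in> colors" "l \<in> colors"
    unfolding colors(1) by simp_all
  show ?thesis
    unfolding card_color_class
    by (rule color_counts_nearly_equal[OF card_V color_counts[OF colors]
          mem[THEN vertices_plus_edges]
          vertices_le_edges[OF mem(3)] vertices_le_edges[OF mem(4)]
          vertices_le_edges[OF mem(4)] vertices_le_edges[OF mem(3)]])
      (use colors(2) in simp_all)
qed

lemma equitable_small:
  assumes "card V \<in> {6, 8, 10, 14}"
  shows "equitable V E c"
proof -
  have le: "card (color_class V E c i) \<le> card (color_class V E c j) + 1"
    if "i \<in> colors" "j \<in> colors" for i j
  proof (cases "i = j")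
    case False
    have "card (colors - {i, j}) = 2"
      using that False by (subst card_Diff_subset) auto
    then obtain k l where kl: "colors - {i, j} = {k, l}" "k \<noteq> l"
      unfolding card_2_iff by blast
    have "colors = {i, j} \<union> (colors - {i, j})"
      using that by blast
    also have "\<dots> = {i, j, k, l}"
      unfolding kl(1) by blast
    finally have "colors = {i, j, k, l}" .
    moreover have "k \<in> colors - {i, j}" "l \<in> colors - {i, j}"
      unfolding kl(1) by simp_all
    then have "distinct [i, j, k, l]"
      using False kl(2) by force
    ultimately show ?thesis
      by (rule card_color_class_le[OF assms])
  qed simp
  show ?thesis
    unfolding equitable_def
  proof (intro ballI)
    fix i j
    assume "i \<in> colors" "j \<in> colors"
    then show "\<bar>int (card (color_class V E c i)) - int (card (color_class V E c j))\<bar> \<le> 1"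
      using le[of i j] le[of j i] by linarith
  qed
qed

lemma equitable_imp_vertices_le:
  assumes "equitable V E c" and "i \<in> colors" "j \<in> colors"
  shows "card (color_vertices V c i) \<le> card (color_vertices V c j) + 2"
proof -
  have "\<bar>int (card (color_class V E c i)) - int (card (color_class V E c j))\<bar> \<le> 1"
    using assms unfolding equitable_def by blast
  then show ?thesis
    using vertices_plus_edges[OF assms(2)] vertices_plus_edges[OF assms(3)]
    by (simp add: card_color_class)
qed

end

section \<open>The cubic graphs of order 4\<close>

text \<open>The complete graph on four vertices is already 3-regular, so a 3-regular subset of its
  edges cannot omit any. This identifies the graph in the vacuous case.\<close>

lemma cubic_graph_order_4:
  assumes "card V = 4"
  shows "cubic_graph V E \<longleftrightarrow> E = complete_edges V"
proof -
  have fin: "finite V"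
    using assms by (simp add: card_ge_0_finite)
  have deg: "card {e \<in> complete_edges V. v \<in> e} = 3" if "v \<in> V" for v
  proof -
    have "{e \<in> complete_edges V. v \<in> e} = (\<lambda>w. {v, w}) ` (V - {v})"
      using that by (auto simp: complete_edges_def card_2_iff)
    moreover have "inj_on (\<lambda>w. {v, w}) (V - {v})"
      by (auto simp: inj_on_def doubleton_eq_iff)
    ultimately show ?thesis
      using assms that fin by (simp add: card_image)
  qed
  show ?thesis
  proof
    assume cubic: "cubic_graph V E"
    then have sub: "E \<subseteq> complete_edges V"
      by (simp add: cubic_graph_def simple_graph_def)
    have fin': "finite (complete_edges V)"
      by (rule finite_subset[of _ "Pow V"]) (use fin in \<open>auto simp: complete_edges_def\<close>)
    have "e \<in> E" if e: "e \<in> complete_edges V" for e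
    proof -
      obtain v where v: "v \<in> e" "v \<in> V"
        using e by (auto simp: complete_edges_def card_2_iff)
      have "{e \<in> E. v \<in> e} = {e \<in> complete_edges V. v \<in> e}"
        using fin' sub deg v cubic by (intro card_subset_eq) (auto simp: cubic_graph_def)
      then show ?thesis
        using e v by blast
    qed
    then show "E = complete_edges V"
      using sub by blast
  qed (use fin deg in \<open>simp add: cubic_graph_def simple_graph_def\<close>)
qed

section \<open>Construction of non-equitable colorings\<close>

text \<open>A colored cubic graph on \<open>{..<n}\<close> is encoded by the color \<open>p v\<close> of each vertex \<open>v\<close> and its
  neighbor \<open>nb v j\<close> along the edge of color \<open>j\<close>; the value \<open>nb v (p v)\<close> is irrelevant.\<close>

definition coded_at :: "nat \<Rightarrow> (nat \<Rightarrow> nat) \<Rightarrow> (nat \<Rightarrow> nat \<Rightarrow> nat) \<Rightarrow> nat \<Rightarrow> bool" where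
  "coded_at n p nb v \<longleftrightarrow> p v \<in> colors \<and>
     (\<forall>j\<in>colors - {p v}. nb v j < n \<and> p (nb v j) \<noteq> p v \<and> p (nb v j) \<noteq> j \<and> nb (nb v j) j = v \<and>
       (\<forall>k\<in>colors - {p v}. nb v j = nb v k \<longrightarrow> j = k))"

definition coded :: "nat \<Rightarrow> (nat \<Rightarrow> nat) \<Rightarrow> (nat \<Rightarrow> nat \<Rightarrow> nat) \<Rightarrow> bool" where
  "coded n p nb \<longleftrightarrow> (\<forall>v\<in>{..<n}. coded_at n p nb v)"

text \<open>The coding condition at \<open>v\<close> concerns only \<open>v\<close> and its
  neighbors, so an injection \<open>h\<close> respecting colors and neighbors transports it.
  Disjoint unions use it for the identity and for a shift.\<close>

lemma coded_at_embed:
  assumes v: "v < n" "coded_at n p nb v"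
    and h: "\<And>w. w < n \<Longrightarrow> h w < m" "\<And>x y. h x = h y \<longleftrightarrow> x = y"
    and q: "\<And>w. w < n \<Longrightarrow> q (h w) = p w" "\<And>w j. w < n \<Longrightarrow> nc (h w) j = h (nb w j)"
  shows "coded_at m q nc (h v)"
proof -
  have p: "p v \<in> colors"
    using v(2) unfolding coded_at_def by (elim conjE)
  have nb: "nb v j < n \<and> p (nb v j) \<noteq> p v \<and> p (nb v j) \<noteq> j \<and> nb (nb v j) j = v \<and>
       (\<forall>k\<in>colors - {p v}. nb v j = nb v k \<longrightarrow> j = k)" if "j \<in> colors - {p v}" for j
    using v(2) that unfolding coded_at_def by (elim conjE) (rule bspec)
  show ?thesis
    unfolding coded_at_def
  proof (intro conjI ballI)
    show "q (h v) \<in> colors"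
      using p q(1)[OF v(1)] by simp
  next
    fix j assume "j \<in> colors - {q (h v)}"
    then have "j \<in> colors - {p v}"
      using q(1)[OF v(1)] by simp
    note j = nb[OF this]
    show "nc (h v) j < m" "q (nc (h v) j) \<noteq> q (h v)" "q (nc (h v) j) \<noteq> j" "nc (nc (h v) j) j = h v"
      using j v(1) by (simp_all add: h q)
    fix k assume "k \<in> colors - {q (h v)}"
    then have "k \<in> colors - {p v}"
      using q(1)[OF v(1)] by simp
    then show "nc (h v) j = nc (h v) k \<longrightarrow> j = k"
      using j v(1) unfolding q(2)[OF v(1)] h(2) by blast
  qed
qed

section \<open>Disjoint unions and building blocks\<close>

text \<open>Only the surplus \<open>d\<close> of color-1 over color-4 vertices is recorded: it is
  additive under disjoint union, and a surplus of at least 4 rules out equitability.\<close>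

definition realizable :: "nat \<Rightarrow> nat \<Rightarrow> bool" where
  "realizable n d \<longleftrightarrow>
     (\<exists>p nb. coded n p nb \<and> card {v \<in> {..<n}. p v = 1} = card {v \<in> {..<n}. p v = 4} + d)"

lemma realizable_0: "realizable 0 0"
  by (auto simp: realizable_def coded_def)

lemma card_append:
  fixes n m :: nat
  shows "card {v \<in> {..<n + m}. (if v < n then p v else q (v - n)) = i} =
     card {v \<in> {..<n}. p v = i} + card {v \<in> {..<m}. q v = (i::nat)}"
proof -
  have "{v \<in> {..<n + m}. (if v < n then p v else q (v - n)) = i} =
      {v \<in> {..<n}. p v = i} \<union> (\<lambda>v. v + n) ` {v \<in> {..<m}. q v = i}" (is "?L = ?A \<union> ?B")
  proof
    show "?L \<subseteq> ?A \<union> ?B"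
    proof
      fix v assume "v \<in> ?L"
      then show "v \<in> ?A \<union> ?B"
        by (cases "v < n") (auto intro!: image_eqI[of _ _ "v - n"])
    qed
  qed auto
  moreover have "card (?A \<union> ?B) = card ?A + card ?B"
    by (rule card_Un_disjoint) auto
  ultimately show ?thesis
    by (simp add: card_image)
qed

text \<open>Disjoint union, with the second graph shifted to the vertices from \<open>n\<close> to
  \<open>n + m - 1\<close>.\<close>

lemma realizable_add:
  assumes "realizable n d" "realizable m d'"
  shows "realizable (n + m) (d + d')"
proof -
  obtain p nb where p: "coded n p nb" "card {v \<in> {..<n}. p v = 1} = card {v \<in> {..<n}. p v = 4} + d"
    using assms(1) by (auto simp: realizable_def)
  obtain q nc where q: "coded m q nc" "card {v \<in> {..<m}. q v = 1} = card {v \<in> {..<m}. q v = 4} + d'"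
    using assms(2) by (auto simp: realizable_def)
  define r where "r = (\<lambda>v. if v < n then p v else q (v - n))"
  define nd where "nd = (\<lambda>v j. if v < n then nb v j else nc (v - n) j + n)"
  have "coded (n + m) r nd"
    unfolding coded_def
  proof
    fix v assume v: "v \<in> {..<n + m}"
    show "coded_at (n + m) r nd v"
    proof (cases "v < n")
      case True
      then have "coded_at n p nb v"
        using p(1) by (simp add: coded_def)
      then show ?thesis
        by (rule coded_at_embed[of v n p nb "\<lambda>w. w", OF True]) (simp_all add: r_def nd_def)
    next
      case False
      then have *: "v - n < m"
        using v by auto
      then have "coded_at m q nc (v - n)"
        using q(1) by (simp add: coded_def)
      then have "coded_at (n + m) r nd (v - n + n)"
        by (rule coded_at_embed[of "v - n" m q nc "\<lambda>w. w + n", OF *]) (simp_all add: r_def nd_def)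
      then show ?thesis
        using False by simp
    qed
  qed
  moreover have "card {v \<in> {..<n + m}. r v = i} =
      card {v \<in> {..<n}. p v = i} + card {v \<in> {..<m}. q v = i}" for i
    unfolding r_def by (rule card_append)
  then have "card {v \<in> {..<n + m}. r v = 1} = card {v \<in> {..<n + m}. r v = 4} + (d + d')"
    using p(2) q(2) by presburger
  ultimately show ?thesis
    unfolding realizable_def by blast
qed

text \<open>The prism on the triangles 0, 2, 4 and 1, 3, 5. Each triangle has vertex colors 1, 2, 3
  and gives every edge the color of its opposite vertex; the edges between the triangles all have
  color 4.\<close>

lemma realizable_6: "realizable 6 2"
proof -
  define p :: "nat \<Rightarrow> nat" where "p v = [1, 1, 2, 2, 3, 3] ! v" for v
  \<comment> \<open>Row \<open>v\<close> lists the neighbors along colors 1 to 4, whence the index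
    \<open>j - 1\<close>; the entry for color \<open>p v\<close> is the filler
    \<open>v\<close>.\<close>
  define nb :: "nat \<Rightarrow> nat \<Rightarrow> nat" where "nb v j = [[0, 4, 2, 3], [1, 5, 3, 4], [4, 2, 0, 5], [5, 3, 1, 0],
    [2, 0, 4, 1], [3, 1, 5, 2]] ! v ! (j - 1)" for v j
  have "coded 6 p nb"
    unfolding coded_def coded_at_def p_def nb_def by code_simp
  moreover have "card {v \<in> {..<6}. p v = 1} = card {v \<in> {..<6}. p v = 4} + 2"
    unfolding p_def by code_simp
  ultimately show ?thesis
    unfolding realizable_def by blast
qed

text \<open>The complete bipartite graph \<open>K_{3,3}\<close> with one vertex replaced by the
  triangle 1, 5, 6.\<close>

lemma realizable_8: "realizable 8 0"
proof -
  define p :: "nat \<Rightarrow> nat" where "p v = [1, 1, 2, 2, 3, 3, 4, 4] ! v" for v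
  define nb :: "nat \<Rightarrow> nat \<Rightarrow> nat" where "nb v j = [[0, 6, 3, 2], [1, 4, 6, 5], [4, 2, 7, 0], [7, 3, 0, 4],
    [2, 1, 4, 3], [6, 7, 5, 1], [5, 0, 1, 6], [3, 5, 2, 7]] ! v ! (j - 1)" for v j
  have "coded 8 p nb"
    unfolding coded_def coded_at_def p_def nb_def by code_simp
  moreover have "card {v \<in> {..<8}. p v = 1} = card {v \<in> {..<8}. p v = 4} + 0"
    unfolding p_def by code_simp
  ultimately show ?thesis
    unfolding realizable_def by blast
qed

text \<open>The prism on the triangles 1, 4, 7 and 3, 5, 8 whose rung from 7 to 5 runs through a
  complete graph minus an edge on 0, 2, 6, 9.\<close>

lemma realizable_10: "realizable 10 2"
proof -
  define p :: "nat \<Rightarrow> nat" where "p v = [1, 1, 1, 1, 2, 2, 3, 3, 4, 4] ! v" for v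
  define nb :: "nat \<Rightarrow> nat \<Rightarrow> nat" where "nb v j = [[0, 6, 9, 7], [1, 7, 8, 4], [2, 9, 5, 6], [3, 8, 4, 5],
    [7, 4, 3, 1], [8, 5, 2, 3], [9, 0, 6, 2], [4, 1, 7, 0], [5, 3, 1, 8], [6, 2, 0, 9]] ! v ! (j - 1)" for v j
  have "coded 10 p nb"
    unfolding coded_def coded_at_def p_def nb_def by code_simp
  moreover have "card {v \<in> {..<10}. p v = 1} = card {v \<in> {..<10}. p v = 4} + 2"
    unfolding p_def by code_simp
  ultimately show ?thesis
    unfolding realizable_def by blast
qed

lemma realizable_mult_6: "realizable (6 * k) (2 * k)"
proof (induction k)
  case (Suc k)
  from realizable_add[OF realizable_6 this] show ?case
    by simp
qed (simp add: realizable_0)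

text \<open>The residue of \<open>n\<close> modulo 6 decides which block joins the prisms. The block
  of order 8 has no surplus, so residue 2 needs two prisms beside it; hence \<open>k \<ge> 3\<close>
  there and the exclusion of 14.\<close>

lemma realizable_large:
  assumes "even n" "n \<ge> 12" "n \<noteq> 14"
  obtains d where "realizable n d" "d \<ge> 4"
proof -
  define k where "k = n div 6"
  have "n = 6 * k \<and> k \<ge> 2 \<or> n = 6 * (k - 1) + 8 \<and> k \<ge> 3 \<or> n = 6 * (k - 1) + 10 \<and> k \<ge> 2"
    using assms unfolding k_def by presburger
  then consider "n = 6 * k" "k \<ge> 2" | "n = 6 * (k - 1) + 8" "k \<ge> 3" | "n = 6 * (k - 1) + 10" "k \<ge> 2"
    by blast
  then show ?thesis
  proof cases
    case 1
    then show ?thesis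
      using that realizable_mult_6[of k] by simp
  next
    case 2
    then show ?thesis
      using that realizable_add[OF realizable_mult_6[of "k - 1"] realizable_8] by simp
  next
    case 3
    then show ?thesis
      using that realizable_add[OF realizable_mult_6[of "k - 1"] realizable_10] by simp
  qed
qed

section \<open>From codes to colored graphs\<close>

text \<open>In \<open>coded_at\<close>, the involution makes adjacency symmetric, distinct end
  colors exclude loops, and injectivity in the color excludes parallel edges. The map
  \<open>f\<close> moves the vertices into the given type.\<close>

lemma coded_imp_colored_graph:
  fixes f :: "nat \<Rightarrow> 'a"
  assumes f: "inj f" and coded: "coded n p nb"
  obtains E c where "colored_cubic_graph (f ` {..<n}) E c" "\<And>v. v < n \<Longrightarrow> c (Inl (f v)) = p v"
proof -
  define C where "C v = colors - {p v}" for v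
  have at: "coded_at n p nb v" if "v < n" for v
    using coded that by (simp add: coded_def)
  have p: "p v \<in> colors" if "v < n" for v
    using at[OF that] unfolding coded_at_def by (elim conjE)
  have nb_all: "nb v j < n \<and> p (nb v j) \<noteq> p v \<and> p (nb v j) \<noteq> j \<and> nb (nb v j) j = v \<and>
       (\<forall>k\<in>C v. nb v j = nb v k \<longrightarrow> j = k)" if "v < n" "j \<in> C v" for v j
    using at[OF that(1)] that(2) unfolding coded_at_def C_def by (elim conjE) (rule bspec)
  have nb: "nb v j < n" "p (nb v j) \<noteq> p v" "p (nb v j) \<noteq> j" "nb (nb v j) j = v"
    if "v < n" "j \<in> C v" for v j
    using nb_all[OF that] by simp_all
  have nb_inj: "j = k" if "v < n" "j \<in> C v" "k \<in> C v" "nb v j = nb v k" for v j k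
    using nb_all[OF that(1,2)] that(3,4) by blast
  have C_nb: "j \<in> C (nb v j)" if "v < n" "j \<in> C v" for v j
    using nb(3)[OF that] that by (auto simp: C_def)
  have f_eq: "f x = f y \<longleftrightarrow> x = y" for x y
    using f by (simp add: inj_eq)
  define edge where "edge v j = {f v, f (nb v j)}" for v j
  define E where "E = {edge v j |v j. v < n \<and> j \<in> C v}"
  \<comment> \<open>An edge is a bare set, so its color is recovered by choice;
    \<open>edge_inj\<close> shows that the edge determines it.\<close>
  define c where "c x = (case x of Inl y \<Rightarrow> p (inv f y)
     | Inr e \<Rightarrow> SOME j. \<exists>v<n. j \<in> C v \<and> e = edge v j)" for x
  have edge_inj: "j = k"
    if v: "v < n" "j \<in> C v" and w: "w < n" "k \<in> C w" and eq: "edge v j = edge w k" for v w j k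
  proof -
    consider "v = w" "nb v j = nb w k" | "v = nb w k" "nb v j = w"
      using eq by (auto simp: edge_def doubleton_eq_iff f_eq)
    then show ?thesis
    proof cases
      case 1
      then show ?thesis
        using nb_inj v w by simp
    next
      case 2
      \<comment> \<open>The ends are swapped; by the involution both \<open>j\<close> and
        \<open>k\<close> lead from \<open>v\<close> to \<open>w\<close>.\<close>
      have "k \<in> C v" "nb v k = w"
        using 2(1) C_nb[OF w] nb(4)[OF w] by simp_all
      then show ?thesis
        using nb_inj v 2(2) by simp
    qed
  qed
  have c_vertex: "c (Inl (f v)) = p v" for v
    using f by (simp add: c_def)
  have c_edge: "c (Inr (edge v j)) = j" if "v < n" "j \<in> C v" for v j
    unfolding c_def using that edge_inj by (auto intro!: some_equality)
  \<comment> \<open>Every edge arises from both of its ends, so one containing \<open>f v\<close>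
    can be rewritten to start at \<open>v\<close>.\<close>
  have incident: "\<exists>j\<in>C v. e = edge v j" if "e \<in> E" "f v \<in> e" for e v
  proof -
    obtain w j where w: "w < n" "j \<in> C w" "e = edge w j"
      using \<open>e \<in> E\<close> by (auto simp: E_def)
    then consider "v = w" | "v = nb w j"
      using \<open>f v \<in> e\<close> by (auto simp: edge_def f_eq)
    then show ?thesis
    proof cases
      case 2
      then have "e = edge v j"
        using w nb(4)[OF w(1,2)] by (simp add: edge_def insert_commute)
      then show ?thesis
        using 2 C_nb w by blast
    qed (use w in blast)
  qed
  let ?V = "f ` {..<n}"
  have "cubic_graph ?V E"
    unfolding cubic_graph_def simple_graph_def
  proof (intro conjI ballI subsetI)
    fix e assume "e \<in> E"
    then obtain v j where v: "v < n" "j \<in> C v" "e = edge v j"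
      by (auto simp: E_def)
    moreover have "v \<noteq> nb v j"
      using nb(2)[OF v(1,2)] by metis
    ultimately show "e \<in> complete_edges ?V"
      using nb(1)[OF v(1,2)] by (auto simp: complete_edges_def edge_def f_eq)
  next
    fix x assume "x \<in> ?V"
    then obtain v where v: "v < n" "x = f v"
      by blast
    have "{e \<in> E. x \<in> e} = edge v ` C v"
    proof
      show "{e \<in> E. x \<in> e} \<subseteq> edge v ` C v"
        using incident[of _ v] v(2) by blast
      show "edge v ` C v \<subseteq> {e \<in> E. x \<in> e}"
        using v by (auto simp: E_def) (simp add: edge_def)
    qed
    moreover have "inj_on (edge v) (C v)"
      using edge_inj v by (auto intro: inj_onI)
    moreover have "card (C v) = 3"
      using p[OF v(1)] by (auto simp: C_def)
    ultimately show "card {e \<in> E. x \<in> e} = 3"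
      by (simp add: card_image)
  qed simp
  moreover have "four_total_coloring ?V E c"
    unfolding four_total_coloring_def
  proof (intro conjI ballI impI subsetI)
    fix i assume "i \<in> c ` (?V <+> E)"
    then consider v where "v < n" "i = c (Inl (f v))" | e where "e \<in> E" "i = c (Inr e)"
      by auto
    then show "i \<in> colors"
    proof cases
      case 1
      then show ?thesis
        using p c_vertex by auto
    next
      case 2
      then show ?thesis
        using c_edge by (auto simp: E_def C_def)
    qed
  next
    fix x y assume "x \<in> ?V" "y \<in> ?V" and e: "{x, y} \<in> E"
    then obtain v where v: "v < n" "x = f v"
      by blast
    then obtain j where j: "j \<in> C v" "{x, y} = edge v j"
      using incident[OF e] by auto
    then have "y = f (nb v j)"
      using v by (auto simp: edge_def doubleton_eq_iff)
    then show "c (Inl x) \<noteq> c (Inl y)"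
      using v nb(2)[OF v(1) j(1)] by (simp add: c_vertex)
  next
    fix e e' assume e: "e \<in> E" "e' \<in> E" "e \<noteq> e' \<and> e \<inter> e' \<noteq> {}"
    then obtain v where v: "v < n" "f v \<in> e" "f v \<in> e'"
      using nb(1) by (auto simp: E_def edge_def)
    then obtain j k where "j \<in> C v" "e = edge v j" "k \<in> C v" "e' = edge v k"
      using incident e by metis
    then show "c (Inr e) \<noteq> c (Inr e')"
      using e v c_edge by auto
  next
    fix x e assume "x \<in> ?V" "e \<in> E" "x \<in> e"
    then obtain v j where "v < n" "x = f v" "j \<in> C v" "e = edge v j"
      using incident by blast
    then show "c (Inl x) \<noteq> c (Inr e)"
      by (auto simp: c_vertex c_edge) (auto simp: C_def)
  qed
  ultimately show ?thesis
    using that c_vertex by (simp add: colored_cubic_graph_def)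
qed

section \<open>Both directions combined\<close>

lemma not_all_equitable_large:
  assumes inf: "infinite (UNIV :: 'a set)" and n: "even n" "n \<ge> 12" "n \<noteq> 14"
  shows "\<not> all_four_total_colorings_equitable TYPE('a) n"
proof
  assume all: "all_four_total_colorings_equitable TYPE('a) n"
  obtain d where "realizable n d" and d: "d \<ge> 4"
    using realizable_large[OF n] .
  then obtain p nb where coded: "coded n p nb"
    and diff: "card {v \<in> {..<n}. p v = 1} = card {v \<in> {..<n}. p v = 4} + d"
    by (auto simp: realizable_def)
  \<comment> \<open>Infinity of the type provides room for the vertices, whatever \<open>n\<close>
    is.\<close>
  obtain f :: "nat \<Rightarrow> 'a" where f: "inj f"
    using inf infinite_countable_subset by blast
  obtain E c where G: "colored_cubic_graph (f ` {..<n}) E c"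
    and c: "\<And>v. v < n \<Longrightarrow> c (Inl (f v)) = p v"
    using coded_imp_colored_graph[OF f coded] by blast
  interpret colored_cubic_graph "f ` {..<n}" E c
    by (rule G)
  have "card (f ` {..<n}) = n"
    using f by (simp add: card_image inj_on_subset)
  then have "equitable (f ` {..<n}) E c"
    using all cubic coloring unfolding all_four_total_colorings_equitable_def by blast
  then have "card (color_vertices (f ` {..<n}) c 1) \<le> card (color_vertices (f ` {..<n}) c 4) + 2"
    by (rule equitable_imp_vertices_le) auto
  moreover have "card (color_vertices (f ` {..<n}) c i) = card {v \<in> {..<n}. p v = i}" for i
  proof -
    have "color_vertices (f ` {..<n}) c i = f ` {v \<in> {..<n}. p v = i}"
      by (auto simp: color_vertices_def c)
    then show ?thesis
      using f by (simp add: card_image inj_on_subset)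
  qed
  ultimately show False
    using diff d by simp
qed

theorem corollary6p3:
  assumes "infinite (UNIV :: 'a set)"
  shows "(\<forall>n. n \<ge> 4 \<and> even n \<longrightarrow>
            (all_four_total_colorings_equitable TYPE('a) n \<longleftrightarrow> n \<in> {4, 6, 8, 10, 14})) \<and>
         (\<forall>V :: 'a set. card V = 4 \<longrightarrow>
            cubic_graph V (complete_edges V) \<and>
            (\<forall>E. cubic_graph V E \<longrightarrow> E = complete_edges V) \<and>
            \<not> (\<exists>c. four_total_coloring V (complete_edges V) c)) \<and>
         (all_four_total_colorings_equitable TYPE('a) 14 \<and>
          (\<forall>n. n \<ge> 4 \<and> even n \<and> all_four_total_colorings_equitable TYPE('a) n \<longrightarrow> n \<le> 14))"
proof -
  have small: "all_four_total_colorings_equitable TYPE('a) n" if "n \<in> {4, 6, 8, 10, 14}" for n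
    unfolding all_four_total_colorings_equitable_def
  proof (intro allI impI)
    fix V :: "'a set" and E c
    assume "cubic_graph V E \<and> card V = n \<and> four_total_coloring V E c"
    then interpret colored_cubic_graph V E c
      by (simp add: colored_cubic_graph_def)
    \<comment> \<open>Order 4 is impossible by \<open>card_V_ne_4\<close>, which leaves the orders
      of \<open>equitable_small\<close>.\<close>
    show "equitable V E c"
      using that card_V_ne_4 \<open>_ \<and> card V = n \<and> _\<close> by (intro equitable_small) auto
  qed
  have large: "n \<in> {4, 6, 8, 10, 14}"
    if "n \<ge> 4" "even n" "all_four_total_colorings_equitable TYPE('a) n" for n
  proof -
    \<comment> \<open>The even orders from 4 up to 11 are exactly 4, 6, 8 and 10.\<close>
    have "n < 12 \<or> n = 14"
      using not_all_equitable_large[OF assms] that by force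
    then show ?thesis
      using that(1,2) by simp presburger
  qed
  have "\<not> four_total_coloring V (complete_edges V) c" if "card V = 4" for V :: "'a set" and c
    using colored_cubic_graph.card_V_ne_4[of V "complete_edges V" c] cubic_graph_order_4[OF that] that
    by (auto simp: colored_cubic_graph_def)
  then have order_4: "\<forall>V :: 'a set. card V = 4 \<longrightarrow> cubic_graph V (complete_edges V) \<and>
      (\<forall>E. cubic_graph V E \<longrightarrow> E = complete_edges V) \<and> \<not> (\<exists>c. four_total_coloring V (complete_edges V) c)"
    by (simp add: cubic_graph_order_4)
  have iff: "\<forall>n. n \<ge> 4 \<and> even n \<longrightarrow>
      (all_four_total_colorings_equitable TYPE('a) n \<longleftrightarrow> n \<in> {4, 6, 8, 10, 14})"
    using small large by blast
  have max: "n \<le> 14" if "n \<ge> 4 \<and> even n \<and> all_four_total_colorings_equitable TYPE('a) n" for n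
    using large[of n] that by auto
  show ?thesis
    using order_4 iff max small[of 14] by blast
qed

end
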